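(* Let $n>1$ and let $\widehat{O}_t$ be a linear differential operator acting on the variable $t$. Let $c_1,c_2$ be real constants and let $I\subseteq(0,\infty)$ be an open interval such that $c_1\ln\left(\tanh\frac{\eta}{2}\right)+c_2>0$ for all $\eta\in I$. Let $f$ be a solution of the equation $\widehat{O}_t f(t)=-f(t)$. Then the function $$u(\eta,t)=f(t)\,\sqrt[n]{c_1\ln\left(\tanh\tfrac{\eta}{2}\right)+c_2},\qquad \eta\in I,$$ is a solution of the equation $$\widehat{O}_t u(\eta,t)=\frac{1}{\sinh\eta}\frac{\partial}{\partial\eta}\left(\sinh\eta\,\frac{\partial u^{n}}{\partial\eta}\right)-u .$$
   Context: Here $\eta>0$ is the hyperbolic distance coordinate, and the operator $\Delta_H=\frac{1}{\sinh\eta}\frac{\partial}{\partial\eta}\sinh\eta\frac{\partial}{\partial\eta}$ is the radial part of the Laplacian on the hyperbolic (Poincaré half) plane. The operator $\widehat{O}_t$ is a linear (possibly fractional) differential operator in time; examples are $\frac{\partial}{\partial t}$, the Laguerre derivative $\frac{\partial}{\partial t}t\frac{\partial}{\partial t}$, and the Caputo derivative of order $\beta\in(0,1)$. Formally: $T\subseteq\mathbb{R}$ is a time interval, $V$ is a linear space of functions on $T$, and $\widehat{O}_t$ is a linear map from $V$ to functions on $T$. It acts on functions of $(\eta,t)$ by fixing $\eta$, i.e. $(\widehat{O}_t u)(\eta,t)=(\widehat{O}_t[u(\eta,\cdot)])(t)$. The function $f$ is an element of $V$. The symbol $\sqrt[n]{\cdot}$ denotes the positive real $n$-th root $x\mapsto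 x^{1/n}$ of a positive real number. The power $u^n$ is the usual real power where it is defined; if $n$ is not an integer and $u$ takes negative values, $u^n$ is the principal complex power (with $0^n=0$). *)

theory Defs
  imports "HOL-Analysis.Analysis"
begin

text \<open>
  Functions on a set \<open>T\<close> of reals are represented by total functions, of which only the values
  on \<open>T\<close> matter. Hence \<open>V\<close> is closed under changing a function outside \<open>T\<close>, and such a change
  does not affect \<open>Op g\<close> on \<open>T\<close>. The values of \<open>Op g\<close> outside \<open>T\<close>, and of \<open>Op\<close> outside \<open>V\<close>,
  are never used.
\<close>

definition function_space_on :: "real set \<Rightarrow> (real \<Rightarrow> real) set \<Rightarrow> bool" where
  "function_space_on T V \<longleftrightarrow>
     (\<lambda>t. 0) \<in> V \<and>
     (\<forall>g\<in>V. \<forall>h\<in>V. (\<lambda>t. g t + h t) \<in> V) \<and>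
     (\<forall>a. \<forall>g\<in>V. (\<lambda>t. a * g t) \<in> V) \<and>
     (\<forall>g\<in>V. \<forall>h. (\<forall>t\<in>T. h t = g t) \<longrightarrow> h \<in> V)"

definition linear_operator_on ::
    "real set \<Rightarrow> (real \<Rightarrow> real) set \<Rightarrow> ((real \<Rightarrow> real) \<Rightarrow> real \<Rightarrow> real) \<Rightarrow> bool" where
  "linear_operator_on T V Op \<longleftrightarrow>
     (\<forall>g\<in>V. \<forall>h\<in>V. \<forall>t\<in>T. Op (\<lambda>s. g s + h s) t = Op g t + Op h t) \<and>
     (\<forall>a. \<forall>g\<in>V. \<forall>t\<in>T. Op (\<lambda>s. a * g s) t = a * Op g t) \<and>
     (\<forall>g\<in>V. \<forall>h\<in>V. (\<forall>t\<in>T. h t = g t) \<longrightarrow> (\<forall>t\<in>T. Op h t = Op g t))"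

text \<open>
  The power of a real number with real exponent \<open>n\<close>: the real power where it is defined, and
  the principal complex power for negative base and non-integer exponent.
\<close>

definition real_cpow :: "real \<Rightarrow> real \<Rightarrow> complex" where
  "real_cpow x n =
     (if n \<in> \<int> then complex_of_real (x powi \<lfloor>n\<rfloor>)
      else if x \<ge> 0 then complex_of_real (x powr n)
      else complex_of_real x powr complex_of_real n)"

text \<open>For positive exponents the three cases agree with the complex power of the library.\<close>

lemma real_cpow_eq_powr:
  assumes "n > 0"
  shows "real_cpow x n = complex_of_real x powr complex_of_real n"
proof (cases "n \<in> \<int>")
  case True
  then obtain k where k: "n = of_int k"
    by (auto elim: Ints_cases)
  define m where "m = nat k"
  have m: "n = of_nat m" "\<lfloor>n\<rfloor> = int m" "m > 0"
    using assms k by (auto simp: m_def)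
  have "complex_of_real x powr of_nat m = complex_of_real x ^ m"
    using m(3) by (simp add: powr_nat)
  then show ?thesis
    using True m by (simp add: real_cpow_def)
next
  case False
  then show ?thesis
    by (auto simp: real_cpow_def powr_of_real)
qed

text \<open>
  The radial part of the hyperbolic Laplacian, for complex-valued functions of the real
  variable \<open>\<eta>\<close>. The value is meaningful only if both derivatives exist, which is
  \<open>laplace_differentiable\<close> below.
\<close>

definition radial_flux :: "(real \<Rightarrow> complex) \<Rightarrow> real \<Rightarrow> complex" where
  "radial_flux g \<eta> = sinh \<eta> *\<^sub>R vector_derivative g (at \<eta>)"

definition radial_laplacian :: "(real \<Rightarrow> complex) \<Rightarrow> real \<Rightarrow> complex" where
  "radial_laplacian g \<eta> = (1 / sinh \<eta>) *\<^sub>R vector_derivative (radial_flux g) (at \<eta>)"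

definition laplace_differentiable :: "(real \<Rightarrow> complex) \<Rightarrow> real set \<Rightarrow> bool" where
  "laplace_differentiable g I \<longleftrightarrow>
     (\<forall>\<eta>\<in>I. g differentiable (at \<eta>) \<and> radial_flux g differentiable (at \<eta>))"

definition solves_time_equation ::
    "real set \<Rightarrow> (real \<Rightarrow> real) set \<Rightarrow> ((real \<Rightarrow> real) \<Rightarrow> real \<Rightarrow> real) \<Rightarrow> (real \<Rightarrow> real) \<Rightarrow> bool" where
  "solves_time_equation T V Op f \<longleftrightarrow> f \<in> V \<and> (\<forall>t\<in>T. Op f t = - f t)"

definition solves_hyperbolic_equation ::
    "real \<Rightarrow> real set \<Rightarrow> real set \<Rightarrow> (real \<Rightarrow> real) set \<Rightarrow> ((real \<Rightarrow> real) \<Rightarrow> real \<Rightarrow> real) \<Rightarrow>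
     (real \<Rightarrow> real \<Rightarrow> real) \<Rightarrow> bool" where
  "solves_hyperbolic_equation n I T V Op u \<longleftrightarrow>
     (\<forall>\<eta>\<in>I. (\<lambda>t. u \<eta> t) \<in> V) \<and>
     (\<forall>t\<in>T. laplace_differentiable (\<lambda>\<eta>. real_cpow (u \<eta> t) n) I) \<and>
     (\<forall>\<eta>\<in>I. \<forall>t\<in>T.
        complex_of_real (Op (\<lambda>s. u \<eta> s) t) =
          radial_laplacian (\<lambda>x. real_cpow (u x t) n) \<eta> - complex_of_real (u \<eta> t))"

end

theory Submission
  imports Defs
begin

text \<open>
  The function \<open>\<eta> \<mapsto> ln (tanh (\<eta> / 2))\<close> is the fundamental radial solution of the hyperbolic
  Laplace equation: its derivative is \<open>1 / sinh \<eta>\<close>, so its flux \<open>sinh \<eta> \<cdot> \<partial>/\<partial>\<eta>\<close> is constant.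
  The \<open>n\<close>-th root is chosen so that \<open>u\<^sup>n\<close> becomes \<open>f(t)\<^sup>n\<close> times an affine function of this
  harmonic function (\<open>real_cpow_mult_root\<close>). For each \<open>t\<close> the nonlinear spatial term therefore
  vanishes (\<open>radial_laplacian_affine_ln_tanh\<close>), and what remains is the equation
  \<open>Op u = -u\<close>, which \<open>u\<close> inherits from \<open>f\<close> because it is a constant multiple of \<open>f\<close> when \<open>\<eta>\<close>
  is fixed and \<open>Op\<close> is linear.
\<close>

lemma has_real_derivative_ln_tanh_half:
  fixes x :: real
  assumes "x > 0"
  shows "((\<lambda>x. ln (tanh (x / 2))) has_real_derivative 1 / sinh x) (at x)"
proof -
  have s: "sinh (x / 2) > 0" and c: "cosh (x / 2) > 0"
    using assms by simp_all
  have double: "sinh x = 2 * sinh (x / 2) * cosh (x / 2)"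
    using sinh_double[of "x / 2"] by simp
  have "((\<lambda>x. ln (tanh (x / 2))) has_real_derivative
          ((1 - tanh (x / 2) ^ 2) * (1 / 2)) / tanh (x / 2)) (at x)"
    using assms s c by (auto intro!: derivative_eq_intros simp: field_simps)
  also have "1 - tanh (x / 2) ^ 2 = (cosh (x / 2) ^ 2 - sinh (x / 2) ^ 2) / cosh (x / 2) ^ 2"
    using c by (simp add: tanh_def power_divide diff_divide_distrib)
  also have "\<dots> = 1 / cosh (x / 2) ^ 2"
    by (simp add: hyperbolic_pythagoras)
  also have "(1 / cosh (x / 2) ^ 2 * (1 / 2)) / tanh (x / 2) = 1 / sinh x"
    using s c by (simp add: double tanh_def field_simps power2_eq_square)
  finally show ?thesis .
qed

text \<open>
  A positive factor does not change the argument of a complex number, so it can be pulled out of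
  the principal power even when \<open>x\<close> is negative.
\<close>

lemma real_cpow_mult_root:
  assumes "n > 0" "a > 0"
  shows "real_cpow (x * a powr (1 / n)) n = complex_of_real a * real_cpow x n"
proof (cases "x = 0")
  case True
  then show ?thesis
    using assms by (simp add: real_cpow_eq_powr)
next
  case False
  have "Ln (complex_of_real (a powr (1 / n)) * complex_of_real x) =
          complex_of_real (ln a / n) + Ln (complex_of_real x)"
    using assms False by (subst Ln_times_of_real) (simp_all add: Ln_of_real ln_powr)
  then have "complex_of_real (x * a powr (1 / n)) powr complex_of_real n =
          exp (complex_of_real (ln a) + complex_of_real n * Ln (complex_of_real x))"
    using assms False by (simp add: powr_def mult.commute ring_distribs)
  also have "\<dots> = complex_of_real a * complex_of_real x powr complex_of_real n"
    using assms False by (simp add: exp_add powr_def exp_of_real)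
  finally show ?thesis
    using assms by (simp add: real_cpow_eq_powr)
qed

text \<open>
  The flux of such a function is the constant \<open>c1 * K\<close>. The function is prescribed only on an
  open set because \<open>u\<^sup>n\<close> has the required form only where the radicand is positive.
\<close>

lemma radial_laplacian_affine_ln_tanh:
  fixes g :: "real \<Rightarrow> complex"
  assumes "open I" "I \<subseteq> {0<..}"
    and g: "\<And>x. x \<in> I \<Longrightarrow> g x = complex_of_real (c1 * ln (tanh (x / 2)) + c2) * K"
  shows "laplace_differentiable g I"
    and "\<And>x. x \<in> I \<Longrightarrow> radial_laplacian g x = 0"
proof -
  have g': "(g has_vector_derivative complex_of_real (c1 / sinh x) * K) (at x)" if "x \<in> I" for x
  proof -
    have "((\<lambda>x. c1 * ln (tanh (x / 2)) + c2) has_real_derivative c1 / sinh x) (at x)"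
      using DERIV_add[OF DERIV_cmult[OF has_real_derivative_ln_tanh_half] DERIV_const, of x c1 c2]
        that assms(2)
      by auto
    then have "((\<lambda>x. complex_of_real (c1 * ln (tanh (x / 2)) + c2) * K)
                 has_vector_derivative complex_of_real (c1 / sinh x) * K) (at x)"
      by (intro has_vector_derivative_mult_left has_vector_derivative_of_real)
         (simp add: has_real_derivative_iff_has_vector_derivative)
    then show ?thesis
      by (rule has_vector_derivative_transform_within_open[OF _ assms(1) that]) (simp add: g)
  qed
  have flux: "radial_flux g x = complex_of_real c1 * K" if "x \<in> I" for x
  proof -
    have "sinh x \<noteq> 0"
      using that assms(2) by auto
    then show ?thesis
      using vector_derivative_at[OF g'[OF that]]
      by (simp add: radial_flux_def scaleR_conv_of_real)
  qed
  have flux': "(radial_flux g has_vector_derivative 0) (at x)" if "x \<in> I" for x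
    by (rule has_vector_derivative_transform_within_open[OF _ assms(1) that,
          where f = "\<lambda>_. complex_of_real c1 * K"])
       (simp_all add: flux)
  show "laplace_differentiable g I"
    unfolding laplace_differentiable_def using g' flux' differentiableI_vector by blast
  show "radial_laplacian g x = 0" if "x \<in> I" for x
    using vector_derivative_at[OF flux'[OF that]] by (simp add: radial_laplacian_def)
qed

theorem theorem1:
  fixes n c1 c2 :: real
    and I T :: "real set"
    and V :: "(real \<Rightarrow> real) set"
    and Op :: "(real \<Rightarrow> real) \<Rightarrow> real \<Rightarrow> real"
    and f :: "real \<Rightarrow> real"
  assumes "n > 1"
    and "is_interval T"
    and "function_space_on T V"
    and "linear_operator_on T V Op"
    and "open I" and "is_interval I" and "I \<subseteq> {0<..}"
    and "\<And>\<eta>. \<eta> \<in> I \<Longrightarrow> c1 * ln (tanh (\<eta> / 2)) + c2 > 0"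
    and "solves_time_equation T V Op f"
  shows "solves_hyperbolic_equation n I T V Op
           (\<lambda>\<eta> t. f t * (c1 * ln (tanh (\<eta> / 2)) + c2) powr (1 / n))"
proof -
  define u where "u = (\<lambda>\<eta> t. f t * (c1 * ln (tanh (\<eta> / 2)) + c2) powr (1 / n))"
  have f: "f \<in> V" "\<And>t. t \<in> T \<Longrightarrow> Op f t = - f t"
    using assms(9) by (auto simp: solves_time_equation_def)
  have u_multiple: "(\<lambda>t. u \<eta> t) = (\<lambda>t. (c1 * ln (tanh (\<eta> / 2)) + c2) powr (1 / n) * f t)" for \<eta>
    by (simp add: u_def mult.commute)
  have u_in: "(\<lambda>t. u \<eta> t) \<in> V" for \<eta>
    using assms(3) f(1) unfolding u_multiple function_space_on_def by blast
  have Op_u: "Op (\<lambda>s. u \<eta> s) t = - u \<eta> t" if "t \<in> T" for \<eta> t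
  proof -
    have "Op (\<lambda>s. u \<eta> s) t = (c1 * ln (tanh (\<eta> / 2)) + c2) powr (1 / n) * Op f t"
      using assms(4) f(1) that unfolding u_multiple linear_operator_on_def by blast
    then show ?thesis
      using f(2)[OF that] by (simp add: u_def mult.commute)
  qed
  have u_power: "real_cpow (u x t) n =
      complex_of_real (c1 * ln (tanh (x / 2)) + c2) * real_cpow (f t) n" if "x \<in> I" for x t
    using assms(1) assms(8)[OF that] by (simp add: u_def real_cpow_mult_root)
  note harmonic = radial_laplacian_affine_ln_tanh[OF assms(5,7) u_power]
  have "solves_hyperbolic_equation n I T V Op u"
    unfolding solves_hyperbolic_equation_def
    using u_in Op_u harmonic by simp
  then show ?thesis
    by (simp add: u_def)
qed

end
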